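(* Let $\{U_k^{(n)}\}_{-1\le k\le K+1}$, $\{P_k^{(n)}\}_{-1\le k\le K+1}$ $(n=0,1,\ldots)$ be a solution of the scheme (S) given in the context. Then $$\left\|\boldsymbol U^{(n)}\right\|_{L^\infty_{\rm d}}\le\frac1L\left|M_{\rm d}(\boldsymbol U^{(0)})\right|+\left\{\frac{2L}{\gamma}\left(J_{\rm d}(\boldsymbol U^{(0)})+L\left|\min\left\{\inf_{\xi\in\mathbb R}F(\xi),0\right\}\right|\right)\right\}^{\frac12}\qquad(n=0,1,\ldots).$$
   Context: Let $L>0$, $\gamma>0$, $K$ a natural number, $\Delta x:=L/K$, and let $\Delta t>0$ be a time mesh size. $F:\mathbb R\to\mathbb R$ is a continuously differentiable potential, bounded from below. Difference operators: $\delta_k^+f_k=\frac{f_{k+1}-f_k}{\Delta x}$, $\delta_k^-f_k=\frac{f_k-f_{k-1}}{\Delta x}$, $\delta_k^{\langle1\rangle}f_k=\frac{f_{k+1}-f_{k-1}}{2\Delta x}$, $\delta_k^{\langle2\rangle}f_k=\frac{f_{k+1}-2f_k+f_{k-1}}{(\Delta x)^2}$. Difference quotient: $\frac{dF}{d(\xi,\eta)}:=\frac{F(\xi)-F(\eta)}{\xi-\eta}$ if $\xi\ne\eta$, and $:=F'(\eta)$ if $\xi=\eta$. Norm: $\|\boldsymbol f\|_{L^\infty_{\rm d}}:=\max_{0\le k\le K}|f_k|$. Discrete mass: $M_{\rm d}(\boldsymbol U):=\Big(\frac12U_0+\sum_{k=1}^{K-1}U_k+\frac12U_K\Big)\Delta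 x$. Discrete energy: with $G^{\pm}_{{\rm d},k}(\boldsymbol U):=\frac{\gamma}{2}(\delta_k^{\pm}U_k)^2+F(U_k)$, $$J_{\rm d}(\boldsymbol U):=\frac12\Big\{\sum_{k=0}^{K-1}G^+_{{\rm d},k}(\boldsymbol U)\Delta x+\sum_{k=1}^{K}G^-_{{\rm d},k}(\boldsymbol U)\Delta x\Big\}.$$ Scheme (S): for all $n=0,1,\ldots$, (1) $\frac{U_k^{(n+1)}-U_k^{(n)}}{\Delta t}=\delta_k^{\langle2\rangle}P_k^{(n)}$ for $k=0,\ldots,K$; (2) $P_k^{(n)}=-\gamma\,\delta_k^{\langle2\rangle}\Big(\frac{U_k^{(n+1)}+U_k^{(n)}}{2}\Big)+\frac{dF}{d(U_k^{(n+1)},U_k^{(n)})}$ for $k=0,\ldots,K$; (3) $\frac{U_0^{(n+1)}-U_0^{(n)}}{\Delta t}=\delta_k^{\langle1\rangle}\Big(\frac{U_k^{(n+1)}+U_k^{(n)}}{2}\Big)\Big|_{k=0}$; (4) $\frac{U_K^{(n+1)}-U_K^{(n)}}{\Delta t}=-\delta_k^{\langle1\rangle}\Big(\frac{U_k^{(n+1)}+U_k^{(n)}}{2}\Big)\Big|_{k=K}$; (5) $\delta_k^{\langle1\rangle}P_k^{(n)}=0$ for $k=0,K$. The values at $k=-1$ and $k=K+1$ are artificial (ghost) quantities. *)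

theory Defs
  imports "HOL-Analysis.Analysis"
begin

text \<open>
  Grid functions have type \<open>int \<Rightarrow> real\<close>, so that the ghost nodes \<open>-1\<close> and \<open>K + 1\<close> are
  ordinary arguments. Only the values at \<open>-1, \<dots>, K + 1\<close> are ever used.
  The parameter \<open>dx\<close> is the space mesh size \<open>L / K\<close>.
\<close>

definition diff_fwd :: "real \<Rightarrow> (int \<Rightarrow> real) \<Rightarrow> int \<Rightarrow> real" where
  "diff_fwd dx f k = (f (k + 1) - f k) / dx"

definition diff_bwd :: "real \<Rightarrow> (int \<Rightarrow> real) \<Rightarrow> int \<Rightarrow> real" where
  "diff_bwd dx f k = (f k - f (k - 1)) / dx"

definition diff_central :: "real \<Rightarrow> (int \<Rightarrow> real) \<Rightarrow> int \<Rightarrow> real" where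
  "diff_central dx f k = (f (k + 1) - f (k - 1)) / (2 * dx)"

definition diff_second :: "real \<Rightarrow> (int \<Rightarrow> real) \<Rightarrow> int \<Rightarrow> real" where
  "diff_second dx f k = (f (k + 1) - 2 * f k + f (k - 1)) / dx\<^sup>2"

definition diff_quot :: "(real \<Rightarrow> real) \<Rightarrow> real \<Rightarrow> real \<Rightarrow> real" where
  "diff_quot F \<xi> \<eta> = (if \<xi> \<noteq> \<eta> then (F \<xi> - F \<eta>) / (\<xi> - \<eta>) else deriv F \<eta>)"

definition norm_Linf :: "nat \<Rightarrow> (int \<Rightarrow> real) \<Rightarrow> real" where
  "norm_Linf K f = Max ((\<lambda>k. \<bar>f k\<bar>) ` {0..int K})"

definition discrete_mass :: "nat \<Rightarrow> real \<Rightarrow> (int \<Rightarrow> real) \<Rightarrow> real" where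
  "discrete_mass K dx U =
     (1/2 * U 0 + (\<Sum>k = 1..int K - 1. U k) + 1/2 * U (int K)) * dx"

definition energy_density_fwd ::
  "real \<Rightarrow> (real \<Rightarrow> real) \<Rightarrow> real \<Rightarrow> (int \<Rightarrow> real) \<Rightarrow> int \<Rightarrow> real" where
  "energy_density_fwd \<gamma> F dx U k = \<gamma> / 2 * (diff_fwd dx U k)\<^sup>2 + F (U k)"

definition energy_density_bwd ::
  "real \<Rightarrow> (real \<Rightarrow> real) \<Rightarrow> real \<Rightarrow> (int \<Rightarrow> real) \<Rightarrow> int \<Rightarrow> real" where
  "energy_density_bwd \<gamma> F dx U k = \<gamma> / 2 * (diff_bwd dx U k)\<^sup>2 + F (U k)"

definition discrete_energy ::
  "real \<Rightarrow> (real \<Rightarrow> real) \<Rightarrow> nat \<Rightarrow> real \<Rightarrow> (int \<Rightarrow> real) \<Rightarrow> real" where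
  "discrete_energy \<gamma> F K dx U =
     1/2 * ((\<Sum>k = 0..int K - 1. energy_density_fwd \<gamma> F dx U k * dx)
          + (\<Sum>k = 1..int K. energy_density_bwd \<gamma> F dx U k * dx))"

text \<open>\<open>U n k\<close> and \<open>P n k\<close> are the values at time step \<open>n\<close> and node \<open>k\<close>.\<close>

definition scheme_solution ::
  "real \<Rightarrow> (real \<Rightarrow> real) \<Rightarrow> nat \<Rightarrow> real \<Rightarrow> real
    \<Rightarrow> (nat \<Rightarrow> int \<Rightarrow> real) \<Rightarrow> (nat \<Rightarrow> int \<Rightarrow> real) \<Rightarrow> bool" where
  "scheme_solution \<gamma> F K dx dt U P \<longleftrightarrow>
     (\<forall>n.
        (\<forall>k\<in>{0..int K}. (U (Suc n) k - U n k) / dt = diff_second dx (P n) k) \<and>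
        (\<forall>k\<in>{0..int K}.
           P n k = - \<gamma> * diff_second dx (\<lambda>j. (U (Suc n) j + U n j) / 2) k
                   + diff_quot F (U (Suc n) k) (U n k)) \<and>
        (U (Suc n) 0 - U n 0) / dt
          = diff_central dx (\<lambda>j. (U (Suc n) j + U n j) / 2) 0 \<and>
        (U (Suc n) (int K) - U n (int K)) / dt
          = - diff_central dx (\<lambda>j. (U (Suc n) j + U n j) / 2) (int K) \<and>
        (\<forall>k\<in>{0, int K}. diff_central dx (P n) k = 0))"

end

theory Submission
  imports Defs
begin

text \<open>
  Summation by parts with trapezoidal weights shows that the scheme conserves the mass (\<open>P\<close> has
  vanishing boundary fluxes) and dissipates the energy (the dynamic boundary conditions contribute
  \<open>- \<gamma> / dt\<close> times a sum of squares). Hence the Dirichlet sum of \<open>U n\<close> is bounded by the initial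
  energy plus the lower bound of \<open>F\<close>. A discrete Poincare inequality bounds the deviation of
  \<open>U n\<close> from its mean, which is the conserved mass divided by \<open>L\<close>.
\<close>

text \<open>Written cell by cell rather than with halved end weights, so that adding a node adds
  exactly one summand and inductions on \<open>K\<close> go through. The mesh factor is left
  out.\<close>

definition trapezoid_sum :: "nat \<Rightarrow> (int \<Rightarrow> real) \<Rightarrow> real" where
  "trapezoid_sum K f = (\<Sum>i<K. (f (int i) + f (int i + 1)) / 2)"

definition dirichlet_sum :: "nat \<Rightarrow> real \<Rightarrow> (int \<Rightarrow> real) \<Rightarrow> real" where
  "dirichlet_sum K dx f = (\<Sum>i<K. (diff_fwd dx f (int i))\<^sup>2) * dx"

lemma sum_atLeastAtMost_int_0: "(\<Sum>k = 0..int K - 1. f k) = (\<Sum>i<K. f (int i))"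
proof (rule sum.reindex_bij_witness[of _ int nat])
qed auto

lemma sum_atLeastAtMost_int_1: "(\<Sum>k = 1..int K. f k) = (\<Sum>i<K. f (int i + 1))"
proof (rule sum.reindex_bij_witness[of _ "\<lambda>i. int i + 1" "\<lambda>k. nat (k - 1)"])
qed auto

lemma trapezoid_sum_add: "trapezoid_sum K (\<lambda>k. f k + g k) = trapezoid_sum K f + trapezoid_sum K g"
  unfolding trapezoid_sum_def sum.distrib[symmetric] by (rule sum.cong) (auto simp: field_simps)

lemma trapezoid_sum_cmult: "trapezoid_sum K (\<lambda>k. c * f k) = c * trapezoid_sum K f"
  unfolding trapezoid_sum_def sum_distrib_left by (rule sum.cong) (auto simp: field_simps)

lemma trapezoid_sum_diff: "trapezoid_sum K (\<lambda>k. f k - g k) = trapezoid_sum K f - trapezoid_sum K g"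
  using trapezoid_sum_add[of K f "\<lambda>k. - 1 * g k"] unfolding trapezoid_sum_cmult by simp

lemma trapezoid_sum_const: "trapezoid_sum K (\<lambda>k. c) = real K * c"
  by (simp add: trapezoid_sum_def)

lemma trapezoid_sum_cong:
  assumes "\<And>k. k \<in> {0..int K} \<Longrightarrow> f k = g k"
  shows "trapezoid_sum K f = trapezoid_sum K g"
  unfolding trapezoid_sum_def by (rule sum.cong) (auto simp: assms)

lemma trapezoid_sum_mono:
  assumes "\<And>k. k \<in> {0..int K} \<Longrightarrow> f k \<le> g k"
  shows "trapezoid_sum K f \<le> trapezoid_sum K g"
  unfolding trapezoid_sum_def by (intro sum_mono divide_right_mono add_mono assms) auto

lemma dirichlet_sum_nonneg: "dx \<ge> 0 \<Longrightarrow> dirichlet_sum K dx f \<ge> 0"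
  by (auto simp: dirichlet_sum_def intro!: mult_nonneg_nonneg sum_nonneg)

text \<open>Averaging the sum over the left ends of the cells with the sum over the right ends
  halves the weights of nodes \<open>0\<close> and \<open>K\<close> only. For \<open>K = 0\<close>
  these nodes coincide, and the left side is \<open>U 0 * dx\<close> while the right side is
  0.\<close>

lemma discrete_mass_eq:
  assumes "K \<ge> 1"
  shows "discrete_mass K dx U = trapezoid_sum K U * dx"
proof -
  have "{0..int K - 1} = insert 0 {1..int K - 1}" "{1..int K} = insert (int K) {1..int K - 1}"
    using assms by auto
  then have "(\<Sum>k = 0..int K - 1. U k) = U 0 + (\<Sum>k = 1..int K - 1. U k)"
    "(\<Sum>k = 1..int K. U k) = U (int K) + (\<Sum>k = 1..int K - 1. U k)"
    by simp_all
  moreover have "trapezoid_sum K U = ((\<Sum>k = 0..int K - 1. U k) + (\<Sum>k = 1..int K. U k)) / 2"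
    unfolding trapezoid_sum_def sum_atLeastAtMost_int_0 sum_atLeastAtMost_int_1
    by (simp add: sum.distrib flip: sum_divide_distrib)
  ultimately show ?thesis
    unfolding discrete_mass_def by (simp add: field_simps)
qed

text \<open>The backward difference at \<open>i + 1\<close> is the forward difference at
  \<open>i\<close>, so both halves of the energy carry the same gradient term on each cell, and the
  potentials at its two ends are averaged.\<close>

lemma discrete_energy_eq:
  "discrete_energy \<gamma> F K dx U =
     \<gamma> / 2 * dirichlet_sum K dx U + trapezoid_sum K (\<lambda>k. F (U k)) * dx"
proof -
  have "discrete_energy \<gamma> F K dx U =
      (\<Sum>i<K. (energy_density_fwd \<gamma> F dx U (int i) * dx
             + energy_density_bwd \<gamma> F dx U (int i + 1) * dx) / 2)"
    unfolding discrete_energy_def sum_atLeastAtMost_int_0 sum_atLeastAtMost_int_1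
    by (simp add: sum.distrib flip: sum_divide_distrib)
  also have "\<dots> = (\<Sum>i<K. \<gamma> / 2 * ((diff_fwd dx U (int i))\<^sup>2 * dx)
                     + (F (U (int i)) + F (U (int i + 1))) / 2 * dx)"
    by (rule sum.cong)
      (auto simp: energy_density_fwd_def energy_density_bwd_def diff_fwd_def diff_bwd_def
        algebra_simps add_divide_distrib)
  finally show ?thesis
    unfolding dirichlet_sum_def trapezoid_sum_def sum.distrib
    by (simp add: sum_distrib_left sum_distrib_right)
qed

text \<open>Induction on \<open>K\<close>, one cell at a time. Central differences appear at the
  boundary because \<open>diff_central\<close> at a node equals the forward difference minus, and
  the backward difference plus, \<open>dx / 2\<close> times \<open>diff_second\<close>: the half
  weight of an end node turns a one-sided flux into a central one.\<close>

lemma summation_by_parts: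
  assumes "dx \<noteq> 0"
  shows "(\<Sum>i<K. diff_fwd dx f (int i) * diff_fwd dx g (int i)) * dx =
     diff_central dx f (int K) * g (int K) - diff_central dx f 0 * g 0
     - trapezoid_sum K (\<lambda>k. diff_second dx f k * g k) * dx"
proof (induction K)
  case 0
  show ?case by (simp add: trapezoid_sum_def)
next
  case (Suc K)
  have "diff_fwd dx f (int K) * diff_fwd dx g (int K) * dx =
      diff_central dx f (int K + 1) * g (int K + 1) - diff_central dx f (int K) * g (int K)
      - (diff_second dx f (int K) * g (int K)
         + diff_second dx f (int K + 1) * g (int K + 1)) / 2 * dx"
    using assms unfolding diff_fwd_def diff_central_def diff_second_def
    by (simp add: field_simps power2_eq_square)
  with Suc show ?case
    by (simp add: trapezoid_sum_def distrib_right add.commute)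
qed

lemma discrete_poincare:
  assumes "dx > 0" and "j \<in> {0..int K}" and "k \<in> {0..int K}"
  shows "\<bar>f j - f k\<bar> \<le> sqrt (real K * dx * dirichlet_sum K dx f)"
proof -
  let ?d = "\<lambda>i. \<bar>diff_fwd dx f (int i)\<bar>"
  have tele: "f (int n) - f (int m) = (\<Sum>i = m..<n. diff_fwd dx f (int i)) * dx" if "m \<le> n" for m n
    using that
  proof (induction n rule: dec_induct)
    case (step n)
    then show ?case
      using assms(1) by (simp add: diff_fwd_def distrib_right add.commute)
  qed simp
  \<comment> \<open>Enlarging the range to all cells makes the bound independent of the chosen pair
    of nodes.\<close>
  have le: "\<bar>f (int n) - f (int m)\<bar> \<le> (\<Sum>i<K. ?d i) * dx" if "m \<le> n" "n \<le> K" for m n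
  proof -
    have "\<bar>\<Sum>i = m..<n. diff_fwd dx f (int i)\<bar> \<le> (\<Sum>i = m..<n. ?d i)"
      by (rule sum_abs)
    also have "\<dots> \<le> (\<Sum>i<K. ?d i)"
      using that by (intro sum_mono2) auto
    finally show ?thesis
      using assms(1) by (simp add: tele[OF that(1)] abs_mult mult_right_mono)
  qed
  have "\<bar>f j - f k\<bar> \<le> (\<Sum>i<K. ?d i) * dx"
  proof (cases "j \<le> k")
    case True
    then show ?thesis
      using le[of "nat j" "nat k"] assms by (simp add: nat_le_iff abs_minus_commute)
  next
    case False
    then show ?thesis
      using le[of "nat k" "nat j"] assms by (simp add: nat_le_iff)
  qed
  also have "\<dots> \<le> sqrt (real K * dx * dirichlet_sum K dx f)"
  proof (rule real_le_rsqrt)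
    \<comment> \<open>The factor 1 brings the sum into the form of Cauchy-Schwarz and produces the
      constant \<open>real K\<close>.\<close>
    have "(\<Sum>i<K. 1 * ?d i)\<^sup>2 \<le> (\<Sum>i<K. 1\<^sup>2) * (\<Sum>i<K. (?d i)\<^sup>2)"
      by (rule Cauchy_Schwarz_ineq_sum)
    then have "(\<Sum>i<K. ?d i)\<^sup>2 * dx\<^sup>2 \<le> real K * (\<Sum>i<K. (diff_fwd dx f (int i))\<^sup>2) * dx\<^sup>2"
      by (intro mult_right_mono) auto
    then show "((\<Sum>i<K. ?d i) * dx)\<^sup>2 \<le> real K * dx * dirichlet_sum K dx f"
      by (simp add: dirichlet_sum_def power2_eq_square algebra_simps)
  qed
  finally show ?thesis .
qed

text \<open>Average the pairwise bound over one of its two nodes; the trapezoidal weights are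
  nonnegative and add up to \<open>K\<close>.\<close>

lemma discrete_poincare_mean:
  assumes "dx > 0" and "K \<ge> 1" and k: "k \<in> {0..int K}"
  shows "\<bar>f k - trapezoid_sum K f / real K\<bar> \<le> sqrt (real K * dx * dirichlet_sum K dx f)"
    (is "_ \<le> ?r")
proof -
  have "trapezoid_sum K f \<le> trapezoid_sum K (\<lambda>_. f k + ?r)"
    "trapezoid_sum K (\<lambda>_. f k - ?r) \<le> trapezoid_sum K f"
    using discrete_poincare[OF assms(1) _ k, of _ f]
    by (force intro!: trapezoid_sum_mono simp: abs_le_iff)+
  then show ?thesis
    using assms(2) unfolding trapezoid_sum_const by (simp add: abs_le_iff field_simps)
qed

text \<open>Discrete chain rule, which makes the change of the potential over a time step exact. In
  the branch \<xi> = \<eta> both sides are 0.\<close>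

lemma diff_quot_mult: "diff_quot F \<xi> \<eta> * (\<xi> - \<eta>) = F \<xi> - F \<eta>"
  by (simp add: diff_quot_def)

lemma mass_step:
  assumes "scheme_solution \<gamma> F K dx dt U P" and "dx > 0" and "dt > 0"
  shows "trapezoid_sum K (U (Suc n)) = trapezoid_sum K (U n)"
proof -
  have bc: "diff_central dx (P n) 0 = 0" "diff_central dx (P n) (int K) = 0"
    and eq: "\<And>k. k \<in> {0..int K} \<Longrightarrow> U (Suc n) k - U n k = dt * diff_second dx (P n) k"
    using assms unfolding scheme_solution_def by (auto simp: field_simps)
  have "trapezoid_sum K (U (Suc n)) - trapezoid_sum K (U n)
      = dt * trapezoid_sum K (\<lambda>k. diff_second dx (P n) k)"
    unfolding trapezoid_sum_diff[symmetric] trapezoid_sum_cmult[symmetric]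
    by (rule trapezoid_sum_cong) (rule eq)
  also have "\<dots> = 0"
    \<comment> \<open>Testing with the constant 1 leaves only the boundary fluxes of
      \<open>P n\<close>, which vanish.\<close>
    using summation_by_parts[of dx "P n" "\<lambda>_. 1" K] assms bc by (simp add: diff_fwd_def)
  finally show ?thesis by simp
qed

text \<open>Test the first scheme equation with \<open>P n\<close> and the second with the increment
  \<open>W\<close>. The interior terms in \<open>V\<close> and \<open>W\<close> cancel, leaving the
  dissipation in the bulk and at the two end nodes.\<close>

lemma energy_step:
  assumes sol: "scheme_solution \<gamma> F K dx dt U P" and "\<gamma> > 0" and "dx > 0" and "dt > 0"
  shows "discrete_energy \<gamma> F K dx (U (Suc n)) \<le> discrete_energy \<gamma> F K dx (U n)"
proof -
  define V where "V = (\<lambda>j. (U (Suc n) j + U n j) / 2)"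
  define W where "W = (\<lambda>j. U (Suc n) j - U n j)"
  have eq: "\<And>k. k \<in> {0..int K} \<Longrightarrow> W k / dt = diff_second dx (P n) k"
    and P: "\<And>k. k \<in> {0..int K} \<Longrightarrow>
      P n k = - \<gamma> * diff_second dx V k + diff_quot F (U (Suc n) k) (U n k)"
    and V0: "diff_central dx V 0 = W 0 / dt"
    and VK: "diff_central dx V (int K) = - (W (int K) / dt)"
    and bc: "diff_central dx (P n) 0 = 0" "diff_central dx (P n) (int K) = 0"
    using sol unfolding scheme_solution_def V_def W_def by auto
  have W: "W k = dt * diff_second dx (P n) k" if "k \<in> {0..int K}" for k
    using eq[OF that] \<open>dt > 0\<close> by (simp add: field_simps)
  have fwd: "diff_fwd dx V i = (diff_fwd dx (U (Suc n)) i + diff_fwd dx (U n) i) / 2"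
    "diff_fwd dx W i = diff_fwd dx (U (Suc n)) i - diff_fwd dx (U n) i" for i
    by (simp_all add: diff_fwd_def V_def W_def algebra_simps diff_divide_distrib add_divide_distrib)
  \<comment> \<open>The midpoint \<open>V\<close> is chosen for the identity a^2 - b^2 = 2 * ((a +
    b) / 2) * (a - b), applied to forward differences.\<close>
  have dir: "dirichlet_sum K dx (U (Suc n)) - dirichlet_sum K dx (U n)
      = 2 * ((\<Sum>i<K. diff_fwd dx V (int i) * diff_fwd dx W (int i)) * dx)"
    unfolding dirichlet_sum_def left_diff_distrib[symmetric] sum_subtractf[symmetric]
      sum_distrib_left sum_distrib_right fwd
    by (intro sum.cong) (auto simp: power2_eq_square algebra_simps)
  have pot: "trapezoid_sum K (\<lambda>k. F (U (Suc n) k)) - trapezoid_sum K (\<lambda>k. F (U n k))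
      = trapezoid_sum K (\<lambda>k. diff_quot F (U (Suc n) k) (U n k) * W k)"
    by (simp add: W_def diff_quot_mult trapezoid_sum_diff)
  have "trapezoid_sum K (\<lambda>k. diff_quot F (U (Suc n) k) (U n k) * W k)
      = trapezoid_sum K (\<lambda>k. dt * (diff_second dx (P n) k * P n k)
          + \<gamma> * (diff_second dx V k * W k))"
  proof (rule trapezoid_sum_cong)
    fix k assume k: "k \<in> {0..int K}"
    have "diff_quot F (U (Suc n) k) (U n k) = P n k + \<gamma> * diff_second dx V k"
      using P[OF k] by simp
    moreover have "P n k * W k = dt * (diff_second dx (P n) k * P n k)"
      using W[OF k] by simp
    ultimately show "diff_quot F (U (Suc n) k) (U n k) * W k =
        dt * (diff_second dx (P n) k * P n k) + \<gamma> * (diff_second dx V k * W k)"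
      by (simp add: algebra_simps)
  qed
  also have "\<dots> = dt * trapezoid_sum K (\<lambda>k. diff_second dx (P n) k * P n k)
      + \<gamma> * trapezoid_sum K (\<lambda>k. diff_second dx V k * W k)"
    by (simp add: trapezoid_sum_add trapezoid_sum_cmult)
  finally have quot: "trapezoid_sum K (\<lambda>k. diff_quot F (U (Suc n) k) (U n k) * W k) = \<dots>" .
  have SP: "trapezoid_sum K (\<lambda>k. diff_second dx (P n) k * P n k) * dx = - dirichlet_sum K dx (P n)"
    using summation_by_parts[of dx "P n" "P n" K] \<open>dx > 0\<close> bc
    by (simp add: dirichlet_sum_def power2_eq_square)
  \<comment> \<open>The dynamic boundary conditions turn each boundary product into minus a square
    over \<open>dt\<close>.\<close>
  have SW: "(\<Sum>i<K. diff_fwd dx V (int i) * diff_fwd dx W (int i)) * dx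
      + trapezoid_sum K (\<lambda>k. diff_second dx V k * W k) * dx
      = - ((W (int K))\<^sup>2 / dt + (W 0)\<^sup>2 / dt)"
    using summation_by_parts[of dx V W K] \<open>dx > 0\<close> V0 VK by (simp add: power2_eq_square)
  have "discrete_energy \<gamma> F K dx (U (Suc n)) - discrete_energy \<gamma> F K dx (U n)
      = \<gamma> / 2 * (dirichlet_sum K dx (U (Suc n)) - dirichlet_sum K dx (U n))
        + (trapezoid_sum K (\<lambda>k. F (U (Suc n) k)) - trapezoid_sum K (\<lambda>k. F (U n k))) * dx"
    unfolding discrete_energy_eq by (simp add: algebra_simps)
  also have "\<dots> = \<gamma> * ((\<Sum>i<K. diff_fwd dx V (int i) * diff_fwd dx W (int i)) * dx
      + trapezoid_sum K (\<lambda>k. diff_second dx V k * W k) * dx)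
      + dt * (trapezoid_sum K (\<lambda>k. diff_second dx (P n) k * P n k) * dx)"
    unfolding dir pot quot by (simp add: algebra_simps)
  also have "\<dots> = - (\<gamma> * ((W (int K))\<^sup>2 / dt + (W 0)\<^sup>2 / dt) + dt * dirichlet_sum K dx (P n))"
    unfolding SP SW by (simp add: algebra_simps)
  finally have "discrete_energy \<gamma> F K dx (U (Suc n)) - discrete_energy \<gamma> F K dx (U n) = \<dots>" .
  moreover have "0 \<le> \<gamma> * ((W (int K))\<^sup>2 / dt + (W 0)\<^sup>2 / dt) + dt * dirichlet_sum K dx (P n)"
    using assms by (simp add: dirichlet_sum_nonneg)
  ultimately show ?thesis by linarith
qed

lemma dirichlet_sum_le_energy:
  assumes "dx \<ge> 0" and "\<And>\<xi>. m \<le> F \<xi>" and "\<gamma> > 0"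
  shows "dirichlet_sum K dx U \<le> 2 / \<gamma> * (discrete_energy \<gamma> F K dx U - real K * dx * m)"
proof -
  have "real K * m \<le> trapezoid_sum K (\<lambda>k. F (U k))"
    unfolding trapezoid_sum_const[symmetric] by (rule trapezoid_sum_mono) (rule assms(2))
  then have "real K * m * dx \<le> trapezoid_sum K (\<lambda>k. F (U k)) * dx"
    using assms(1) by (rule mult_right_mono)
  then show ?thesis
    using assms(3) unfolding discrete_energy_eq by (simp add: field_simps)
qed

theorem theorem3p1:
  fixes L \<gamma> dx dt :: real
    and K :: nat
    and F :: "real \<Rightarrow> real"
    and U P :: "nat \<Rightarrow> int \<Rightarrow> real"
  assumes "L > 0" and "\<gamma> > 0" and "K \<ge> 1"
    and "dx = L / real K" and "dt > 0"
    and "F C1_differentiable_on UNIV"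
    and "bdd_below (range F)"
    and "scheme_solution \<gamma> F K dx dt U P"
  shows "\<forall>n. norm_Linf K (U n) \<le>
           1 / L * \<bar>discrete_mass K dx (U 0)\<bar>
           + sqrt (2 * L / \<gamma> *
               (discrete_energy \<gamma> F K dx (U 0) + L * \<bar>min (INF \<xi>. F \<xi>) 0\<bar>))"
proof
  fix n
  \<comment> \<open>Capping the infimum at 0 keeps \<open>m\<close> a lower bound of
    \<open>F\<close> and gives \<open>- m = \<bar>m\<bar>\<close>, the form in which it enters the
    estimate.\<close>
  define m where "m = min (INF \<xi>. F \<xi>) 0"
  have dx: "dx > 0" and L: "L = real K * dx"
    using assms by auto
  have m: "m \<le> F \<xi>" for \<xi>
    using cINF_lower[OF assms(7), of \<xi>] by (simp add: m_def min.coboundedI1)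
  have mass: "trapezoid_sum K (U n) = trapezoid_sum K (U 0)"
    by (induction n) (simp_all add: mass_step[OF assms(8) dx assms(5)])
  have energy: "discrete_energy \<gamma> F K dx (U n) \<le> discrete_energy \<gamma> F K dx (U 0)"
    by (induction n) (auto intro: order.trans energy_step[OF assms(8,2) dx assms(5)])
  have "dirichlet_sum K dx (U n) \<le> 2 / \<gamma> * (discrete_energy \<gamma> F K dx (U n) - real K * dx * m)"
    using dx m assms(2) by (intro dirichlet_sum_le_energy) auto
  also have "\<dots> \<le> 2 / \<gamma> * (discrete_energy \<gamma> F K dx (U 0) + L * \<bar>m\<bar>)"
    using energy assms(2) unfolding L by (intro mult_left_mono) (auto simp: m_def)
  finally have "L * dirichlet_sum K dx (U n)
      \<le> L * (2 / \<gamma> * (discrete_energy \<gamma> F K dx (U 0) + L * \<bar>m\<bar>))"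
    using assms(1) by (intro mult_left_mono) auto
  then have r: "sqrt (L * dirichlet_sum K dx (U n))
      \<le> sqrt (2 * L / \<gamma> * (discrete_energy \<gamma> F K dx (U 0) + L * \<bar>m\<bar>))"
    by (simp add: mult_ac)
  \<comment> \<open>By mass conservation the mean about which \<open>U n\<close> is estimated is the
    same at every time step.\<close>
  have mean: "trapezoid_sum K (U n) / real K = discrete_mass K dx (U 0) / L"
    using dx assms(3) by (simp add: discrete_mass_eq mass L)
  have "\<bar>U n k\<bar> \<le> 1 / L * \<bar>discrete_mass K dx (U 0)\<bar>
      + sqrt (2 * L / \<gamma> * (discrete_energy \<gamma> F K dx (U 0) + L * \<bar>m\<bar>))" if "k \<in> {0..int K}" for k
  proof -
    have "\<bar>U n k - discrete_mass K dx (U 0) / L\<bar> \<le> sqrt (L * dirichlet_sum K dx (U n))"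
      using discrete_poincare_mean[OF dx assms(3) that, of "U n"] unfolding mean L[symmetric] .
    moreover have "\<bar>discrete_mass K dx (U 0) / L\<bar> = 1 / L * \<bar>discrete_mass K dx (U 0)\<bar>"
      using assms(1) by simp
    ultimately show ?thesis
      using r by linarith
  qed
  then show "norm_Linf K (U n) \<le> 1 / L * \<bar>discrete_mass K dx (U 0)\<bar>
      + sqrt (2 * L / \<gamma> *
          (discrete_energy \<gamma> F K dx (U 0) + L * \<bar>min (INF \<xi>. F \<xi>) 0\<bar>))"
    unfolding norm_Linf_def m_def by (subst Max_le_iff) auto
qed

end
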